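(* Let $G$ be an orderly topological group. Then every compact subgroup of $G$ is trivial.
   Context: The interval topology of a linearly ordered set has as subbase all rays $\{x: a<x\}$, $\{x: x<b\}$. A compact linearly ordered space is a linearly ordered set whose interval topology is compact, equipped with that topology. $H_+(K)$ is the group of all order-preserving homeomorphisms $K\to K$ with the compact-open topology. A topological group is orderly if it embeds as a topological group (injective homomorphism, homeomorphism onto its image) into $H_+(K)$ for some compact linearly ordered space $K$. *)

theory Defs
  imports "HOL-Analysis.Analysis" "HOL-Algebra.Algebra"
begin

locale topological_group = group G for G (structure) +
  fixes T :: "'a topology"
  assumes topspace_eq_carrier: "topspace T = carrier G"
    and continuous_mult: "continuous_map (prod_topology T T) T (\<lambda>(x, y). x \<otimes> y)"
    and continuous_inv: "continuous_map T T (\<lambda>x. inv x)"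

definition order_homeos :: "('k::linorder_topology \<Rightarrow> 'k) set" where
  "order_homeos = {f. mono f \<and> homeomorphic_map euclidean euclidean f}"

definition H_plus :: "('k::linorder_topology \<Rightarrow> 'k) monoid" where
  "H_plus = \<lparr>carrier = order_homeos, mult = (\<circ>), one = id\<rparr>"

text \<open>Since \<open>C = {}\<close> is allowed, the generating sets cover \<open>F\<close>, so the
  underlying set of this topology is \<open>F\<close>.\<close>

definition compact_open_topology ::
    "('a::topological_space \<Rightarrow> 'b::topological_space) set \<Rightarrow> ('a \<Rightarrow> 'b) topology" where
  "compact_open_topology F =
     topology_generated_by {{f \<in> F. f ` C \<subseteq> U} | C U. compact C \<and> open U}"

lemma topspace_compact_open_topology [simp]: "topspace (compact_open_topology F) = F"
proof -
  have "F \<in> {{f \<in> F. f ` C \<subseteq> U} | C U. compact C \<and> open U}"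
    by (rule CollectI, rule exI[of _ "{}"], rule exI[of _ UNIV]) auto
  then show ?thesis
    unfolding compact_open_topology_def topology_generated_by_topspace by blast
qed

lemma group_H_plus: "group (H_plus :: ('k::linorder_topology \<Rightarrow> 'k) monoid)"
proof (rule groupI)
  fix f :: "'k \<Rightarrow> 'k" assume "f \<in> carrier H_plus"
  then obtain g where mono: "mono f" and g: "homeomorphic_maps euclidean euclidean f g"
    by (auto simp: H_plus_def order_homeos_def homeomorphic_map_maps)
  then have gf: "\<And>x. g (f x) = x" and fg: "\<And>y. f (g y) = y"
    by (simp_all add: homeomorphic_maps_def)
  have "mono g"
  proof (rule monoI)
    fix x y :: 'k assume "x \<le> y"
    show "g x \<le> g y"
    proof (cases "g x \<le> g y")
      case False
      then have "f (g y) \<le> f (g x)" by (intro monoD[OF mono]) simp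
      then have "x = y" using \<open>x \<le> y\<close> by (simp add: fg)
      then show ?thesis by simp
    qed
  qed
  moreover have "homeomorphic_map euclidean euclidean g"
    using g homeomorphic_maps_sym homeomorphic_map_maps by blast
  moreover have "g \<circ> f = id"
    using gf by (simp add: fun_eq_iff)
  ultimately show "\<exists>g\<in>carrier H_plus. g \<otimes>\<^bsub>H_plus\<^esub> f = \<one>\<^bsub>H_plus\<^esub>"
    by (intro bexI[of _ g]) (simp_all add: H_plus_def order_homeos_def)
next
  fix f g :: "'k \<Rightarrow> 'k" assume "f \<in> carrier H_plus" "g \<in> carrier H_plus"
  then show "f \<otimes>\<^bsub>H_plus\<^esub> g \<in> carrier H_plus"
    using homeomorphic_map_compose[of euclidean euclidean g euclidean f]
    by (simp add: H_plus_def order_homeos_def mono_def)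
next
  have "homeomorphic_map euclidean euclidean (id :: 'k \<Rightarrow> 'k)"
    by simp
  then show "\<one>\<^bsub>H_plus\<^esub> \<in> carrier (H_plus :: ('k \<Rightarrow> 'k) monoid)"
    by (simp add: H_plus_def order_homeos_def mono_def)
qed (simp_all add: H_plus_def comp_assoc)

text \<open>The type \<open>'k\<close> plays the role of the linearly ordered set \<open>K\<close>: the class
  \<open>linorder_topology\<close> says that its open sets are those generated by the open rays.
  As HOL cannot quantify over types inside a formula, \<open>'k\<close> is a parameter; left free in the
  hypothesis of a theorem, it expresses ``for some \<open>K\<close>''.\<close>

definition orderly :: "'k::linorder_topology itself \<Rightarrow> ('a, 'b) monoid_scheme \<Rightarrow> 'a topology \<Rightarrow> bool"
  where
  "orderly _ G T \<longleftrightarrow>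
     compact (UNIV :: 'k set) \<and>
     (\<exists>\<phi> \<in> mon G (H_plus :: ('k \<Rightarrow> 'k) monoid).
        embedding_map T (compact_open_topology order_homeos) \<phi>)"

end

theory Submission
  imports Defs
begin

text \<open>A compact group of order-preserving maps sends each point \<open>x\<close> to an orbit that is compact and
  hence has a maximum \<open>m\<close>. The group permutes the orbit preserving the order, so it fixes \<open>m\<close>; as
  \<open>x\<close> lies in the orbit of \<open>m\<close>, it equals \<open>m\<close> and is fixed.\<close>

text \<open>Points are compact, so the preimage of an open \<open>U\<close> under evaluation at
  \<open>x\<close> is the subbasic set given by \<open>C = {x}\<close>.\<close>

lemma continuous_map_compact_open_eval:
  "continuous_map (compact_open_topology F) euclidean (\<lambda>f. f x)"
proof -
  have "openin (compact_open_topology F) {f \<in> F. f x \<in> U}" if "open U" for U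
    unfolding compact_open_topology_def
  proof (rule topology_generated_by_Basis, rule CollectI)
    show "\<exists>C V. {f \<in> F. f x \<in> U} = {f \<in> F. f ` C \<subseteq> V} \<and> compact C \<and> open V"
      using that by (intro exI[of _ "{x}"] exI[of _ U]) simp
  qed
  then show ?thesis
    by (simp add: continuous_map)
qed

text \<open>The order-theoretic core, free of topology: compactness is to be used only to supply an
  \<open>h\<close> at which the orbit of \<open>x\<close> attains its maximum.\<close>

lemma orbit_max_fixed:
  fixes S :: "('k::linorder \<Rightarrow> 'k) set"
  assumes comp: "\<And>f g. f \<in> S \<Longrightarrow> g \<in> S \<Longrightarrow> f \<circ> g \<in> S"
    and inv: "\<And>f. f \<in> S \<Longrightarrow> \<exists>g\<in>S. \<forall>x. f (g x) = x \<and> g (f x) = x"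
    and mono: "\<And>f. f \<in> S \<Longrightarrow> mono f"
    and h: "h \<in> S" and max: "\<And>f. f \<in> S \<Longrightarrow> f x \<le> h x"
    and f: "f \<in> S"
  shows "f x = x"
proof -
  have le: "g (h x) \<le> h x" if "g \<in> S" for g
    using max[OF comp[OF that h]] by simp
  have fix_max: "g (h x) = h x" if "g \<in> S" for g
  proof (rule antisym[OF le[OF that]])
    \<comment> \<open>The inverse cannot push the maximum up either:
      \<open>g' (h x) \<le> h x\<close>, and applying the monotone \<open>g\<close> gives the
      reverse inequality.\<close>
    obtain g' where "g' \<in> S" "\<forall>x. g (g' x) = x \<and> g' (g x) = x"
      using inv[OF \<open>g \<in> S\<close>] by blast
    then show "h x \<le> g (h x)"
      using monoD[OF mono[OF that] le[of g']] by simp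
  qed
  \<comment> \<open>The inverse \<open>h'\<close> fixes the maximum \<open>h x\<close> but also
    sends it back to \<open>x\<close>, so the two points coincide.\<close>
  obtain h' where "h' \<in> S" "\<forall>x. h (h' x) = x \<and> h' (h x) = x"
    using inv[OF h] by blast
  then have "h x = x"
    using fix_max by metis
  then show ?thesis
    using fix_max[OF f] by simp
qed

theorem proposition4p7:
  fixes G :: "('a, 'b) monoid_scheme" and T :: "'a topology" and H :: "'a set"
  assumes "topological_group G T"
    and "orderly TYPE('k::linorder_topology) G T"
    and "subgroup H G"
    and "compactin T H"
  shows "H = {\<one>\<^bsub>G\<^esub>}"
proof -
  interpret G: topological_group G T by fact
  interpret H: subgroup H G by fact
  obtain \<phi> where \<phi>: "\<phi> \<in> mon G (H_plus :: ('k \<Rightarrow> 'k) monoid)"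
    and emb: "embedding_map T (compact_open_topology order_homeos) \<phi>"
    using assms(2) by (auto simp: orderly_def)
  have hom: "\<phi> \<in> hom G (H_plus :: ('k \<Rightarrow> 'k) monoid)" and inj: "inj_on \<phi> (carrier G)"
    using \<phi> by (simp_all add: mon_def)
  interpret \<phi>: group_hom G "H_plus :: ('k \<Rightarrow> 'k) monoid" \<phi>
    using hom by (simp add: group_hom_def group_hom_axioms_def group_H_plus)
  have mult: "\<phi> (a \<otimes>\<^bsub>G\<^esub> b) = \<phi> a \<circ> \<phi> b" if "a \<in> carrier G" "b \<in> carrier G" for a b
    using hom_mult[OF hom that] by (simp add: H_plus_def)
  have one: "\<one>\<^bsub>H_plus\<^esub> = (id :: 'k \<Rightarrow> 'k)"
    by (simp add: H_plus_def)
  have "\<phi> a = id" if a: "a \<in> H" for a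
  proof
    fix x
    \<comment> \<open>An embedding is a homeomorphism onto its image with the subspace topology,
      hence continuous into the whole space.\<close>
    have "continuous_map T (compact_open_topology order_homeos) \<phi>"
      using emb homeomorphic_imp_continuous_map continuous_map_in_subtopology
      unfolding embedding_map_def by blast
    then have "continuous_map T (euclidean :: 'k topology) ((\<lambda>f. f x) \<circ> \<phi>)"
      using continuous_map_compact_open_eval
      by (rule continuous_map_compose)
    \<comment> \<open>The orbit of \<open>x\<close> is the image of the compact \<open>H\<close>
      under \<open>\<phi>\<close> followed by evaluation at \<open>x\<close>.\<close>
    then have "compact ((\<lambda>b. \<phi> b x) ` H)"
      using image_compactin[OF assms(4)] by (force simp: comp_def)
    moreover have "(\<lambda>b. \<phi> b x) ` H \<noteq> {}"
      using a by blast
    ultimately obtain h where h: "h \<in> H" "\<And>b. b \<in> H \<Longrightarrow> \<phi> b x \<le> \<phi> h x"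
      using compact_attains_sup[of "(\<lambda>b. \<phi> b x) ` H"] by blast
    have "\<phi> a x = x"
    proof (rule orbit_max_fixed[where S = "\<phi> ` H" and h = "\<phi> h"])
      fix f g assume "f \<in> \<phi> ` H" "g \<in> \<phi> ` H"
      then show "f \<circ> g \<in> \<phi> ` H"
        by (auto simp del: \<phi>.hom_mult simp flip: mult)
    next
      fix f assume "f \<in> \<phi> ` H"
      then obtain b where b: "b \<in> H" "f = \<phi> b" by blast
      \<comment> \<open>Both composites are images under \<open>\<phi>\<close> of products in
        \<open>G\<close> equal to the identity, so the inverse of \<open>\<phi> b\<close> again
        comes from \<open>H\<close>.\<close>
      have "\<phi> b \<circ> \<phi> (inv\<^bsub>G\<^esub> b) = id" "\<phi> (inv\<^bsub>G\<^esub> b) \<circ> \<phi> b = id"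
        using b by (simp_all add: one del: \<phi>.hom_mult \<phi>.hom_inv flip: mult)
      then show "\<exists>g\<in>\<phi> ` H. \<forall>x. f (g x) = x \<and> g (f x) = x"
        using b by (intro bexI[of _ "\<phi> (inv\<^bsub>G\<^esub> b)"]) (auto simp: fun_eq_iff simp del: \<phi>.hom_inv)
    next
      fix f assume "f \<in> \<phi> ` H"
      then show "mono f"
        using \<phi>.hom_closed by (auto simp: H_plus_def order_homeos_def)
    qed (use a h in auto)
    then show "\<phi> a x = id x" by simp
  qed
  \<comment> \<open>\<open>\<phi>\<close> sends both \<open>a\<close> and the identity of
    \<open>G\<close> to \<open>id\<close>, and it is injective.\<close>
  then have "a = \<one>\<^bsub>G\<^esub>" if "a \<in> H" for a
    using inj_onD[OF inj, of a "\<one>\<^bsub>G\<^esub>"] that one by simp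
  then show ?thesis
    using H.one_closed by blast
qed

end
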